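(* Let $N,M\ge0$ be integers and $Q=abcd$. With all sums over $(m_1,m_2,m_3,m_4)\in\mathbb{N}^4$ with $m_1+m_2+m_3+m_4=N$ and $\begin{bmatrix}\cdot\\ \cdot\end{bmatrix}=\begin{bmatrix}\cdot\\ \cdot\end{bmatrix}_Q$: $$\sum_{\pi\in\mathcal{S}^2_{2N,2M+1}}\omega^2_\pi=\sum\begin{bmatrix}M+1\\ m_1\end{bmatrix}a^{m_1}Q^{\binom{m_1}{2}}\begin{bmatrix}M+m_2\\ m_2\end{bmatrix}(ab)^{m_2}\begin{bmatrix}M\\ m_3\end{bmatrix}(abc)^{m_3}Q^{\binom{m_3}{2}}\begin{bmatrix}M+m_4\\ m_4\end{bmatrix},$$ $$\sum_{\pi\in\mathcal{S}^2_{2N+1,2M+1}}\omega^2_\pi=\sum\begin{bmatrix}M\\ m_1\end{bmatrix}(1+a)a^{m_1}Q^{\binom{m_1+1}{2}}\begin{bmatrix}M+m_2\\ m_2\end{bmatrix}(ab)^{m_2}\begin{bmatrix}M\\ m_3\end{bmatrix}(abc)^{m_3}Q^{\binom{m_3}{2}}\begin{bmatrix}M+m_4\\ m_4\end{bmatrix},$$ $$\sum_{\pi\in\mathcal{S}^2_{2N,2M}}\omega^2_\pi=\sum\begin{bmatrix}M\\ m_1\end{bmatrix}a^{m_1}Q^{\binom{m_1}{2}}\begin{bmatrix}M+m_2-1\\ m_2\end{bmatrix}(ab)^{m_2}\begin{bmatrix}M\\ m_3\end{bmatrix}(abc)^{m_3}Q^{\binom{m_3}{2}}\begin{bmatrix}M+m_4\\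 m_4\end{bmatrix},$$ $$\sum_{\pi\in\mathcal{S}^2_{2N+1,2M}}\omega^2_\pi=\sum\begin{bmatrix}M-1\\ m_1\end{bmatrix}(1+a)a^{m_1}Q^{\binom{m_1+1}{2}}\begin{bmatrix}M+m_2-1\\ m_2\end{bmatrix}(ab)^{m_2}\begin{bmatrix}M\\ m_3\end{bmatrix}(abc)^{m_3}Q^{\binom{m_3}{2}}\begin{bmatrix}M+m_4\\ m_4\end{bmatrix},$$ where $\omega^2_\pi=\omega^2_\pi(a,b,c,d)$.
   Context: $\mathcal{S}^2_{N',M'}$ is the set of partitions whose odd parts are all distinct, with largest part $\le N'$ and at most $M'$ parts (empty partition included). The weight $\omega^2_\pi(a,b,c,d)$ is the product of labels when cells of each odd-indexed row of the Ferrers diagram (top row indexed 1) are labelled left to right alternately $a,b,\dots$ and cells of each even-indexed row alternately $c,d,\dots$. $\begin{bmatrix}n\\ k\end{bmatrix}_q=\frac{(q;q)_n}{(q;q)_k(q;q)_{n-k}}$ for $n\ge k\ge0$ and $0$ otherwise, $(q;q)_n=\prod_{i=1}^n(1-q^i)$.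
   Formalization: The third and fourth identities are proved for M ≥ 1 only: at M = 0 the left side is 1 (the empty partition), while with the stated convention every term on the right contains [m_2−1; m_2] = 0. *)

theory Defs
  imports Complex_Main "HOL-Computational_Algebra.Polynomial"
begin

definition qpoch :: "'a::comm_ring_1 \<Rightarrow> nat \<Rightarrow> 'a" where
  "qpoch q n = (\<Prod>i = 1..n. 1 - q ^ i)"

text \<open>
  The Gaussian binomial is the quotient taken in \<open>\<int>[X]\<close>, where \<open>div\<close> is exact division
  (the lemma \<open>qpoch_dvd\<close> below shows that the division leaves no remainder). It is then evaluated
  at an element of an arbitrary commutative ring, so that roots of unity need no special treatment.
  Over a field it is the usual quotient whenever the denominator does not vanish
  (\<open>qbinom_eq_divide\<close>). It is \<open>0\<close> unless \<open>0 \<le> k \<le> n\<close>; the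
  arguments are integers so that differences in them are not truncated. In particular the value at
  \<open>(-1, 0)\<close> is \<open>0\<close>.
\<close>

definition gauss_poly :: "nat \<Rightarrow> nat \<Rightarrow> int poly" where
  "gauss_poly n k = qpoch [:0, 1:] n div (qpoch [:0, 1:] k * qpoch [:0, 1:] (n - k))"

definition qbinom :: "int \<Rightarrow> int \<Rightarrow> 'a::comm_ring_1 \<Rightarrow> 'a" where
  "qbinom n k q =
     (if 0 \<le> k \<and> k \<le> n then poly (map_poly of_int (gauss_poly (nat n) (nat k))) q else 0)"

lemma qpoch_0 [simp]: "qpoch q 0 = 1"
  by (simp add: qpoch_def)

lemma qpoch_Suc: "qpoch q (Suc n) = qpoch q n * (1 - q ^ Suc n)"
  by (simp add: qpoch_def)

lemma qpoch_dvd: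
  fixes q :: "'a::comm_ring_1"
  assumes "k \<le> n"
  shows "qpoch q k * qpoch q (n - k) dvd qpoch q n"
  using assms
proof (induction n arbitrary: k)
  case 0
  then show ?case by simp
next
  case (Suc n)
  show ?case
  proof (cases "k = 0 \<or> k = Suc n")
    case True
    then show ?thesis by auto
  next
    case False
    then obtain j where k: "k = Suc j" and j: "Suc j \<le> n"
      using Suc.prems by (cases k) auto
    have s: "n - j = Suc (n - Suc j)"
      using j by simp
    obtain g where g: "qpoch q n = qpoch q j * qpoch q (n - j) * g"
      using Suc.IH[of j] j by (auto elim: dvdE)
    obtain h where h: "qpoch q n = qpoch q (Suc j) * qpoch q (n - Suc j) * h"
      using Suc.IH[of "Suc j"] j by (auto elim: dvdE)
    have pw: "q ^ Suc n = q ^ Suc j * q ^ (n - j)"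
      using j by (simp flip: power_Suc power_add)
    have sj: "qpoch q (n - j) = qpoch q (n - Suc j) * (1 - q ^ (n - j))"
      unfolding s by (rule qpoch_Suc)
    have "qpoch q (Suc n) = qpoch q n * (1 - q ^ Suc j) + qpoch q n * (q ^ Suc j * (1 - q ^ (n - j)))"
      unfolding qpoch_Suc pw by (simp add: algebra_simps)
    also have "qpoch q n * (1 - q ^ Suc j) = qpoch q (Suc j) * qpoch q (n - j) * g"
      unfolding g qpoch_Suc by (simp only: mult_ac)
    also have "qpoch q n * (q ^ Suc j * (1 - q ^ (n - j)))
        = qpoch q (Suc j) * qpoch q (n - j) * (h * q ^ Suc j)"
      unfolding h sj by (simp only: mult_ac)
    finally show ?thesis
      unfolding k by (simp flip: distrib_left)
  qed
qed

lemma qpoch_X_nonzero: "qpoch [:0, 1::int:] n \<noteq> 0"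
proof -
  have "poly (1 - [:0, 1::int:] ^ i) 2 \<noteq> 0" if "i \<ge> 1" for i
    using that by (simp add: poly_power)
  then have "1 - [:0, 1::int:] ^ i \<noteq> 0" if "i \<ge> 1" for i
    using that by (metis poly_0)
  then show ?thesis
    by (auto simp: qpoch_def)
qed

lemma gauss_poly_mult:
  assumes "k \<le> n"
  shows "gauss_poly n k * (qpoch [:0, 1:] k * qpoch [:0, 1:] (n - k)) = qpoch [:0, 1:] n"
  unfolding gauss_poly_def using qpoch_dvd[OF assms] by (rule dvd_div_mult_self)

lemma qbinom_mult:
  fixes q :: "'a::comm_ring_1"
  assumes "k \<le> n"
  shows "qbinom (int n) (int k) q * (qpoch q k * qpoch q (n - k)) = qpoch q n"
proof -
  define ev where "ev p = poly (map_poly of_int p) q" for p :: "int poly"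
  have ev_pCons: "ev (pCons c p) = of_int c + q * ev p" for c p
    by (cases "p = 0 \<and> c = 0") (auto simp: ev_def map_poly_pCons)
  have ev_0: "ev 0 = 0" and ev_1: "ev 1 = 1"
    by (simp_all add: ev_def)
  have ev_add: "ev (p + r) = ev p + ev r" for p r
  proof (induction p r rule: poly_induct2)
    case (pCons a p b r)
    then show ?case by (simp add: ev_pCons algebra_simps)
  qed (simp add: ev_0)
  have ev_diff: "ev (p - r) = ev p - ev r" for p r
    using ev_add[of "p - r" r] by simp
  have ev_smult: "ev (smult c p) = of_int c * ev p" for c p
    by (induction p) (simp_all add: ev_0 ev_pCons algebra_simps)
  have ev_mult: "ev (p * r) = ev p * ev r" for p r
    by (induction p) (simp_all add: ev_0 ev_pCons ev_add ev_smult algebra_simps)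
  have ev_X: "ev [:0, 1:] = q"
    by (simp add: ev_pCons ev_0)
  have ev_power: "ev (p ^ i) = ev p ^ i" for p i
    by (induction i) (simp_all add: ev_1 ev_mult)
  have ev_qpoch: "ev (qpoch [:0, 1:] m) = qpoch q m" for m
    by (induction m) (simp_all add: ev_1 qpoch_Suc ev_mult ev_diff ev_power ev_X del: power_Suc)
  have "qbinom (int n) (int k) q = ev (gauss_poly n k)"
    using assms by (simp add: qbinom_def ev_def)
  then show ?thesis
    using arg_cong[OF gauss_poly_mult[OF assms], of ev] by (simp add: ev_mult ev_qpoch)
qed

lemma qbinom_eq_divide:
  fixes q :: "'a::field"
  assumes "k \<le> n" and "qpoch q k * qpoch q (n - k) \<noteq> 0"
  shows "qbinom (int n) (int k) q = qpoch q n / (qpoch q k * qpoch q (n - k))"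
  using qbinom_mult[OF assms(1), of q] assms(2) by (simp add: eq_divide_eq)

text \<open>A partition is the weakly decreasing list of its (positive) parts.\<close>

definition is_partition :: "nat list \<Rightarrow> bool" where
  "is_partition p \<longleftrightarrow> sorted_wrt (\<ge>) p \<and> (\<forall>x \<in> set p. 0 < x)"

definition S2 :: "nat \<Rightarrow> nat \<Rightarrow> nat list set" where
  "S2 N M = {p. is_partition p \<and> distinct (filter odd p) \<and> (\<forall>x \<in> set p. x \<le> N) \<and> length p \<le> M}"

lemma finite_S2: "finite (S2 N M)"
  by (rule finite_subset[OF _ finite_lists_length_le[of "{..N}" M]]) (auto simp: S2_def)

text \<open>
  Rows and columns are indexed from 0, so the odd-indexed rows of the usual 1-based numbering
  are the even ones here.
\<close>

definition cell_label :: "'a \<Rightarrow> 'a \<Rightarrow> 'a \<Rightarrow> 'a \<Rightarrow> nat \<Rightarrow> nat \<Rightarrow> 'a" where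
  "cell_label a b c d i j =
     (if even i then (if even j then a else b) else (if even j then c else d))"

definition omega2 :: "'a::comm_ring_1 \<Rightarrow> 'a \<Rightarrow> 'a \<Rightarrow> 'a \<Rightarrow> nat list \<Rightarrow> 'a" where
  "omega2 a b c d p = (\<Prod>i<length p. \<Prod>j<p ! i. cell_label a b c d i j)"

definition quads :: "nat \<Rightarrow> (nat \<times> nat \<times> nat \<times> nat) set" where
  "quads N = {(m1, m2, m3, m4). m1 + m2 + m3 + m4 = N}"

lemma finite_quads: "finite (quads N)"
  by (rule finite_subset[of _ "{..N} \<times> {..N} \<times> {..N} \<times> {..N}"]) (auto simp: quads_def)

end

theory Submission
  imports Defs "HOL-Computational_Algebra.Formal_Power_Series"
begin

text \<open>
  Deleting the largest part \<open>n\<close> of a partition swaps the two kinds of rows and leaves a partition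
  with parts at most \<open>2 * (n div 2)\<close>. Write \<open>E\<^sub>K(z; a,b,c,d)\<close> for the generating function
  \<open>\<Sum>\<^sub>N z\<^sup>N \<Sum>\<^bsub>\<pi> \<in> S2 (2N) K\<^esub> \<omega>(\<pi>)\<close>. The parts \<open>2N\<close> and \<open>2N - 1\<close>
  then give \<open>(1 - z) E\<^bsub>K+1\<^esub>(z; a,b,c,d) = (1 + az) E\<^sub>K(abz; c,d,a,b)\<close>, so that \<open>E\<^sub>K\<close> is a
  quotient of products of linear factors; likewise the bounds \<open>2N + 1\<close> lead to
  \<open>(1 + a) E\<^sub>K(abz; c,d,a,b) / (1 - z)\<close>. Expanding the four products by the \<open>q\<close>-binomial theorems
  and comparing coefficients of \<open>z\<^sup>N\<close> yields the claim.
\<close>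

unbundle fps_syntax

section \<open>Gaussian binomials\<close>

lemma gauss_poly_0 [simp]: "gauss_poly n 0 = 1"
  using gauss_poly_mult[of 0 n] qpoch_X_nonzero[of n] by simp

lemma gauss_poly_self [simp]: "gauss_poly n n = 1"
  using gauss_poly_mult[of n n] qpoch_X_nonzero[of n] by simp

text \<open>The q-Pascal rule. Over the common denominator \<open>D\<close> it reduces to 1 -
  X^(n+1) = (1 - X^(n-k)) + X^(n-k) (1 - X^(k+1)); \<open>D\<close> is nonzero and cancels in the
  integral domain of integer polynomials.\<close>

lemma gauss_poly_Suc_Suc:
  assumes "k < n"
  shows "gauss_poly (Suc n) (Suc k) = gauss_poly n (Suc k) + monom 1 (n - k) * gauss_poly n k"
proof -
  define X where "X = [:0, 1::int:]"
  obtain j where n: "n = Suc (k + j)"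
    using assms less_iff_Suc_add by blast
  define D where "D = qpoch X (Suc k) * qpoch X (Suc j)"
  have D: "D \<noteq> 0"
    using qpoch_X_nonzero by (simp add: D_def X_def)
  have mon: "monom 1 (n - k) = X ^ Suc j"
    by (simp add: n X_def monom_altdef del: power_Suc)
  have 1: "gauss_poly (Suc n) (Suc k) * D = qpoch X n * (1 - X ^ Suc n)"
    using gauss_poly_mult[of "Suc k" "Suc n"] by (simp add: n D_def X_def qpoch_Suc)
  have "gauss_poly n (Suc k) * (qpoch X (Suc k) * qpoch X j) = qpoch X n"
    using gauss_poly_mult[of "Suc k" n] by (simp add: n X_def)
  then have 2: "gauss_poly n (Suc k) * D = qpoch X n * (1 - X ^ Suc j)"
    by (simp add: D_def qpoch_Suc[of X j] mult_ac del: power_Suc)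
  have "gauss_poly n k * (qpoch X k * qpoch X (Suc j)) = qpoch X n"
    using gauss_poly_mult[of k n] by (simp add: n X_def Suc_diff_le)
  then have 3: "gauss_poly n k * D = qpoch X n * (1 - X ^ Suc k)"
    by (simp add: D_def qpoch_Suc[of X k] mult_ac del: power_Suc)
  have pw: "X ^ Suc n = X ^ Suc j * X ^ Suc k"
    by (simp add: n add.commute flip: power_add power_Suc)
  have "(gauss_poly n (Suc k) + monom 1 (n - k) * gauss_poly n k) * D
      = gauss_poly n (Suc k) * D + X ^ Suc j * (gauss_poly n k * D)"
    by (simp add: mon algebra_simps del: power_Suc)
  also have "\<dots> = qpoch X n * (1 - X ^ Suc n)"
    unfolding 2 3 pw by (simp add: algebra_simps del: power_Suc)
  finally show ?thesis
    using 1 D by (metis mult_right_cancel)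
qed

lemma qbinom_0 [simp]: "qbinom (int n) 0 q = 1"
  by (simp add: qbinom_def map_poly_1)

lemma qbinom_self [simp]: "qbinom (int n) (int n) q = 1"
  by (simp add: qbinom_def map_poly_1)

lemma qbinom_eq_0: "n < k \<Longrightarrow> qbinom (int n) (int k) q = 0"
  by (simp add: qbinom_def)

text \<open>For \<open>k < n\<close> the polynomial identity is carried over coefficientwise:
  \<open>map_poly of_int\<close> respects sums and multiplication by monomials. For
  \<open>k = n\<close> it reads 1 = 0 + 1, and beyond that all terms vanish.\<close>

lemma qbinom_Suc_Suc:
  "qbinom (int (Suc n)) (int (Suc k)) q
     = qbinom (int n) (int (Suc k)) q + q ^ (n - k) * qbinom (int n) (int k) q"
proof (cases n k rule: linorder_cases)
  case greater
  have add: "map_poly of_int (p + r) = (map_poly of_int p + map_poly of_int r :: 'a poly)" for p r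
    by (rule poly_eqI) (simp add: coeff_map_poly)
  have mon: "map_poly of_int (monom 1 i * p) = (monom 1 i * map_poly of_int p :: 'a poly)" for i p
    by (rule poly_eqI) (simp add: coeff_map_poly coeff_monom_mult)
  from greater have "int (Suc k) \<le> int n" by simp
  then show ?thesis
    using greater
    by (simp add: qbinom_def nat_add_distrib gauss_poly_Suc_Suc add mon poly_monom del: of_nat_Suc)
qed (simp_all add: qbinom_eq_0 del: of_nat_Suc)

section \<open>The q-binomial theorems\<close>

definition lin :: "'a::comm_ring_1 \<Rightarrow> 'a fps" where
  "lin x = 1 + fps_const x * fps_X"

lemma lin_nth_0 [simp]: "lin x $ 0 = 1"
  by (simp add: lin_def)

lemma lin_mult_nth_0 [simp]: "(lin x * f) $ 0 = f $ 0"
  by (simp add: lin_def distrib_right)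

lemma lin_mult_nth_Suc [simp]: "(lin x * f) $ Suc n = f $ Suc n + x * f $ n"
  by (simp add: lin_def distrib_right mult.assoc)

definition lprod :: "'a::comm_ring_1 \<Rightarrow> 'a \<Rightarrow> nat \<Rightarrow> 'a fps" where
  "lprod q x n = (\<Prod>i<n. lin (x * q ^ i))"

lemma lprod_0 [simp]: "lprod q x 0 = 1"
  by (simp add: lprod_def)

lemma lprod_Suc: "lprod q x (Suc n) = lin (x * q ^ n) * lprod q x n"
  by (simp add: lprod_def mult.commute)

lemma lprod_Suc_shift: "lprod q x (Suc n) = lin x * lprod q (x * q) n"
  unfolding lprod_def by (subst prod.lessThan_Suc_shift) (simp add: mult.assoc)

text \<open>The expansion in z of the product of the n factors 1 + x q^i z, i < n.\<close>

definition qpos :: "'a::comm_ring_1 \<Rightarrow> 'a \<Rightarrow> nat \<Rightarrow> 'a fps" where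
  "qpos q x n = Abs_fps (\<lambda>m. qbinom (int n) (int m) q * x ^ m * q ^ (m choose 2))"

text \<open>The expansion of the reciprocal of the product of 1 - x q^i z over i \<le> n. There are
  n + 1 factors, so that the upper entry \<open>n + m\<close> involves no subtraction.\<close>

definition qneg :: "'a::comm_ring_1 \<Rightarrow> 'a \<Rightarrow> nat \<Rightarrow> 'a fps" where
  "qneg q x n = Abs_fps (\<lambda>m. qbinom (int (n + m)) (int m) q * x ^ m)"

text \<open>The q-Pascal rule in each coefficient: raising the exponent from
  \<open>k choose 2\<close> to \<open>Suc k choose 2\<close> supplies q^k, which turns the factor
  q^(n-k) into q^n. For k > n both sides have coefficient 0.\<close>

lemma qpos_Suc: "qpos q x (Suc n) = lin (x * q ^ n) * qpos q x n"
proof (rule fps_ext)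
  fix m
  show "qpos q x (Suc n) $ m = (lin (x * q ^ n) * qpos q x n) $ m"
  proof (cases m)
    case 0
    then show ?thesis
      using qbinom_0[of "Suc n" q] by (simp add: qpos_def numeral_2_eq_2 del: of_nat_Suc)
  next
    case (Suc k)
    have c: "Suc k choose 2 = (k choose 2) + k"
      by (simp add: numeral_2_eq_2)
    show ?thesis
    proof (cases "k \<le> n")
      case True
      then have "q ^ (n - k) * q ^ k = q ^ n"
        by (simp flip: power_add)
      then show ?thesis
        unfolding Suc lin_mult_nth_Suc
        by (simp add: qpos_def qbinom_Suc_Suc c power_add algebra_simps del: of_nat_Suc)
           (metis (no_types, lifting) mult.assoc mult.left_commute)
    qed (simp add: Suc qpos_def qbinom_eq_0 del: of_nat_Suc)
  qed
qed

lemma lprod_eq_qpos: "lprod q x n = qpos q x n"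
proof (induction n)
  case 0
  have "qpos q x 0 $ m = (1 :: 'a fps) $ m" for m
    using qbinom_0[of 0 q] qbinom_eq_0[of 0 m q] by (cases m) (simp_all add: qpos_def numeral_2_eq_2)
  then show ?case
    by (simp add: fps_ext)
qed (simp add: lprod_Suc qpos_Suc)

text \<open>The q-Pascal rule with upper entry \<open>Suc n + k\<close>, where the power of q is
  exactly \<open>Suc n\<close>.\<close>

lemma qneg_Suc: "lin (- x * q ^ Suc n) * qneg q x (Suc n) = qneg q x n"
proof (rule fps_ext)
  fix m
  show "(lin (- x * q ^ Suc n) * qneg q x (Suc n)) $ m = qneg q x n $ m"
  proof (cases m)
    case 0
    then show ?thesis
      using qbinom_0[of "Suc n" q] by (simp add: qneg_def del: of_nat_Suc)
  next
    case (Suc k)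
    show ?thesis
      unfolding Suc lin_mult_nth_Suc
      using qbinom_Suc_Suc[of "Suc n + k" k q]
      by (simp add: qneg_def algebra_simps del: of_nat_Suc of_nat_add)
  qed
qed

text \<open>Stated as an inverse pair, which makes sense over any commutative ring. The base case is
  the geometric series; each further factor is absorbed by \<open>qneg_Suc\<close>.\<close>

lemma lprod_mult_qneg: "lprod q (- x) (Suc n) * qneg q x n = 1"
proof (induction n)
  case 0
  have "(lin (- x) * qneg q x 0) $ m = (1 :: 'a fps) $ m" for m
    by (cases m) (simp_all add: qneg_def del: of_nat_Suc)
  then show ?case
    by (simp add: lprod_Suc fps_ext)
next
  case (Suc n)
  have "lprod q (- x) (Suc (Suc n)) * qneg q x (Suc n)
      = lprod q (- x) (Suc n) * (lin (- x * q ^ Suc n) * qneg q x (Suc n))"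
    by (simp only: lprod_Suc[of q "- x" "Suc n"] mult_ac)
  then show ?case
    using Suc by (simp only: qneg_Suc)
qed

lemma lprod_cancel:
  assumes "F * (lprod q (- x) (Suc m) * lprod q (- y) (Suc n)) = G"
  shows "F = G * (qneg q x m * qneg q y n)"
proof -
  have "G * (qneg q x m * qneg q y n)
      = F * ((lprod q (- x) (Suc m) * qneg q x m) * (lprod q (- y) (Suc n) * qneg q y n))"
    unfolding assms[symmetric] by (simp only: mult_ac)
  then show ?thesis
    by (simp add: lprod_mult_qneg)
qed

section \<open>Coefficients of fourfold products\<close>

text \<open>The index set of the nested Cauchy products: \<open>i\<close> is the degree m1 + m2
  taken by the first pair of factors, \<open>j\<close> is m1 and \<open>k\<close> is m3.\<close>

lemma quads_conv_Sigma:
  "quads N = (\<lambda>(i, j, k). (j, i - j, k, N - i - k)) ` (SIGMA i:{0..N}. {0..i} \<times> {0..N - i})"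
proof (intro equalityI subsetI)
  fix t assume "t \<in> quads N"
  then obtain m1 m2 m3 m4 where "t = (m1, m2, m3, m4)" "m1 + m2 + m3 + m4 = N"
    by (auto simp: quads_def)
  then show "t \<in> (\<lambda>(i, j, k). (j, i - j, k, N - i - k)) ` (SIGMA i:{0..N}. {0..i} \<times> {0..N - i})"
    by (intro image_eqI[of _ _ "(m1 + m2, m1, m3)"]) auto
qed (auto simp: quads_def)

lemma fps_mult4_nth:
  fixes A B C D :: "'a::comm_ring_1 fps"
  shows "((A * B) * (C * D)) $ N = (\<Sum>(m1, m2, m3, m4)\<in>quads N. A $ m1 * B $ m2 * C $ m3 * D $ m4)"
proof -
  have inj: "inj_on (\<lambda>(i, j, k). (j, i - j, k, N - i - k)) (SIGMA i:{0..N}. {0..i} \<times> {0..N - i})"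
    by (auto simp: inj_on_def)
  show ?thesis
    unfolding quads_conv_Sigma
    by (subst sum.reindex[OF inj])
       (simp add: fps_mult_nth sum_product sum.cartesian_product sum.Sigma split_def
          mult.assoc[where 'a = 'a])
qed

section \<open>Generating functions of partitions\<close>

definition S2_gf :: "nat \<Rightarrow> nat \<Rightarrow> 'a::comm_ring_1 \<Rightarrow> 'a \<Rightarrow> 'a \<Rightarrow> 'a \<Rightarrow> 'a" where
  "S2_gf N K a b c d = (\<Sum>p \<in> S2 N K. omega2 a b c d p)"

lemma omega2_Nil [simp]: "omega2 a b c d [] = 1"
  by (simp add: omega2_def)

text \<open>Below the top row every row index drops by one, so row parities flip and the label pairs
  a, b and c, d change places.\<close>

lemma omega2_Cons:
  "omega2 a b c d (n # p) = (\<Prod>j<n. if even j then a else b) * omega2 c d a b p"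
proof -
  have "cell_label a b c d (Suc i) j = cell_label c d a b i j" for i j
    by (simp add: cell_label_def)
  then show ?thesis
    unfolding omega2_def list.size add_0_right add_Suc_right
    by (subst prod.lessThan_Suc_shift) (simp add: cell_label_def)
qed

lemma prod_alternating_even: "(\<Prod>j<2 * n. if even j then a else b) = (a * b :: 'a::comm_ring_1) ^ n"
  by (induction n) (simp_all add: mult_ac)

lemma S2_0_left [simp]: "S2 0 K = {[]}"
proof -
  have "p = []" if "p \<in> S2 0 K" for p
    using that by (cases p) (auto simp: S2_def is_partition_def)
  then show ?thesis
    by (auto simp: S2_def is_partition_def)
qed

lemma S2_0_right [simp]: "S2 N 0 = {[]}"
  by (auto simp: S2_def is_partition_def)

text \<open>An even part \<open>Suc n\<close> may repeat, so the rest is still bounded by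
  \<open>Suc n\<close>; an odd one may not, so the rest is bounded by \<open>n\<close>. In both
  cases this is the largest even number not exceeding \<open>Suc n\<close>.\<close>

lemma Cons_in_S2_iff:
  "Suc n # p \<in> S2 (Suc n) (Suc K) \<longleftrightarrow> p \<in> S2 (2 * (Suc n div 2)) K"
proof (cases "odd n")
  case True
  then have "2 * (Suc n div 2) = Suc n"
    by simp
  with True show ?thesis
    by (auto simp: S2_def is_partition_def)
next
  case False
  then have e: "2 * (Suc n div 2) = n"
    by simp
  have "(\<forall>x\<in>set p. x \<le> Suc n) \<and> Suc n \<notin> set p \<longleftrightarrow> (\<forall>x\<in>set p. x \<le> n)"
    by (metis le_SucE le_SucI not_less_eq_eq order_refl)
  with False show ?thesis
    unfolding e by (auto simp: S2_def is_partition_def)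
qed

lemma S2_Suc_Suc:
  "S2 (Suc n) (Suc K) = S2 n (Suc K) \<union> (#) (Suc n) ` S2 (2 * (Suc n div 2)) K"
proof (intro equalityI subsetI)
  fix p assume p: "p \<in> S2 (Suc n) (Suc K)"
  show "p \<in> S2 n (Suc K) \<union> (#) (Suc n) ` S2 (2 * (Suc n div 2)) K"
  proof (cases "\<exists>r. p = Suc n # r")
    case True
    then show ?thesis
      using p Cons_in_S2_iff by blast
  next
    case False
    \<comment> \<open>The head is the largest part; it differs from \<open>Suc n\<close>, hence it
      bounds all parts by \<open>n\<close>.\<close>
    have "x \<le> n" if "x \<in> set p" for x
      using p that False by (cases p) (fastforce simp: S2_def is_partition_def)+
    with p show ?thesis
      by (auto simp: S2_def)
  qed
next
  fix p assume "p \<in> S2 n (Suc K) \<union> (#) (Suc n) ` S2 (2 * (Suc n div 2)) K"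
  then show "p \<in> S2 (Suc n) (Suc K)"
  proof
    assume "p \<in> S2 n (Suc K)"
    then show ?thesis
      by (auto simp: S2_def)
  qed (use Cons_in_S2_iff in blast)
qed

lemma S2_gf_Suc_Suc:
  "S2_gf (Suc n) (Suc K) a b c d = S2_gf n (Suc K) a b c d
     + (\<Prod>j<Suc n. if even j then a else b) * S2_gf (2 * (Suc n div 2)) K c d a b"
proof -
  have "S2 n (Suc K) \<inter> (#) (Suc n) ` S2 (2 * (Suc n div 2)) K = {}"
    by (auto simp: S2_def)
  then show ?thesis
    unfolding S2_gf_def S2_Suc_Suc
    by (subst sum.union_disjoint)
       (auto simp: finite_S2 sum.reindex omega2_Cons sum_distrib_left)
qed

lemma S2_gf_odd:
  "S2_gf (Suc (2 * N)) (Suc K) a b c d = S2_gf (2 * N) (Suc K) a b c d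
     + a * (a * b) ^ N * S2_gf (2 * N) K c d a b"
  by (subst S2_gf_Suc_Suc) (simp add: prod_alternating_even mult.commute[of "(a * b) ^ N" a])

lemma S2_gf_even:
  "S2_gf (2 * Suc N) (Suc K) a b c d = S2_gf (Suc (2 * N)) (Suc K) a b c d
     + (a * b) ^ Suc N * S2_gf (2 * Suc N) K c d a b"
  using S2_gf_Suc_Suc[of "Suc (2 * N)" K a b c d] prod_alternating_even[of a b "Suc N"]
  by simp

text \<open>The parameter \<open>x\<close> rescales the variable, so that \<open>z \<mapsto> abz\<close> needs no composition of power series.\<close>

definition even_fps :: "nat \<Rightarrow> 'a::comm_ring_1 \<Rightarrow> 'a \<Rightarrow> 'a \<Rightarrow> 'a \<Rightarrow> 'a \<Rightarrow> 'a fps" where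
  "even_fps K x a b c d = Abs_fps (\<lambda>N. x ^ N * S2_gf (2 * N) K a b c d)"

definition odd_fps :: "nat \<Rightarrow> 'a::comm_ring_1 \<Rightarrow> 'a \<Rightarrow> 'a \<Rightarrow> 'a \<Rightarrow> 'a \<Rightarrow> 'a fps" where
  "odd_fps K x a b c d = Abs_fps (\<lambda>N. x ^ N * S2_gf (Suc (2 * N)) K a b c d)"

section \<open>Functional equations\<close>

text \<open>A top part 2n+2 leaves the bound 2n+2 and yields the constant term of
  \<open>lin (a * x)\<close>; a top part 2n+1 leaves the bound 2n and yields its linear
  term.\<close>

lemma even_fps_Suc:
  "lin (- x) * even_fps (Suc K) x a b c d = lin (a * x) * even_fps K (x * (a * b)) c d a b"
proof (rule fps_ext)
  fix N
  show "(lin (- x) * even_fps (Suc K) x a b c d) $ N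
      = (lin (a * x) * even_fps K (x * (a * b)) c d a b) $ N"
  proof (cases N)
    case 0
    then show ?thesis
      by (simp add: even_fps_def S2_gf_def)
  next
    case (Suc n)
    then show ?thesis
      using S2_gf_even[of n K a b c d] S2_gf_odd[of n K a b c d]
      by (simp add: even_fps_def power_mult_distrib algebra_simps)
  qed
qed

text \<open>The new top parts 2n+2 and 2n+3 both leave the bound 2n+2, so their weights combine to
  the constant 1 + a instead of a linear factor.\<close>

lemma odd_fps_Suc:
  "lin (- x) * odd_fps (Suc K) x a b c d = fps_const (1 + a) * even_fps K (x * (a * b)) c d a b"
proof (rule fps_ext)
  fix N
  show "(lin (- x) * odd_fps (Suc K) x a b c d) $ N
      = (fps_const (1 + a) * even_fps K (x * (a * b)) c d a b) $ N"
  proof (cases N)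
    case 0
    then show ?thesis
      using S2_gf_odd[of 0 K a b c d] by (simp add: even_fps_def odd_fps_def S2_gf_def)
  next
    case (Suc n)
    then show ?thesis
      using S2_gf_even[of n K a b c d] S2_gf_odd[of "Suc n" K a b c d]
      by (simp add: even_fps_def odd_fps_def power_mult_distrib algebra_simps)
  qed
qed

lemma even_fps_0: "lin (- x) * even_fps 0 x a b c d = 1"
proof (rule fps_ext)
  show "(lin (- x) * even_fps 0 x a b c d) $ N = 1 $ N" for N
    by (cases N) (simp_all add: even_fps_def S2_gf_def)
qed

section \<open>Product formulas\<close>

text \<open>Two row deletions restore the order of the labels and scale x by (ab)(cd) = Q, so the
  linear factors collect into four products with ratio Q. The denominators stay on the left, which
  avoids division.\<close>

lemma even_fps_product:
  fixes a b c d x :: "'a::comm_ring_1"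
  assumes "Q = a * b * c * d"
  shows "even_fps (2 * M) x a b c d * (lprod Q (- (a * b * x)) M * lprod Q (- x) (Suc M))
           = lprod Q (a * x) M * lprod Q (a * b * c * x) M"
    and "even_fps (Suc (2 * M)) x a b c d
             * (lprod Q (- (a * b * x)) (Suc M) * lprod Q (- x) (Suc M))
           = lprod Q (a * x) (Suc M) * lprod Q (a * b * c * x) M"
proof -
  \<comment> \<open>The passage from 2M to 2M+1 rows takes the even case as a premise for all
    labels, since it is needed within the induction for that case as well as for the second
    claim.\<close>
  have step: "even_fps (Suc (2 * M)) x a b c d
             * (lprod Q (- (a * b * x)) (Suc M) * lprod Q (- x) (Suc M))
           = lprod Q (a * x) (Suc M) * lprod Q (a * b * c * x) M"
    if IH: "\<And>x a b c d :: 'a. Q = a * b * c * d \<Longrightarrow>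
         even_fps (2 * M) x a b c d * (lprod Q (- (a * b * x)) M * lprod Q (- x) (Suc M))
           = lprod Q (a * x) M * lprod Q (a * b * c * x) M"
      and Q: "Q = a * b * c * d" for M and x a b c d :: 'a
  proof -
    let ?y = "x * (a * b)"
    have "Q = c * d * a * b" by (simp add: Q mult_ac)
    note IH = IH[OF this, of ?y]
    \<comment> \<open>At the swapped labels and \<open>?y\<close>, one product above and one below
      start at \<open>a * x * Q\<close> and \<open>x * Q\<close>; the factors
      \<open>lin (a * x)\<close> and \<open>lin (- x)\<close> complete them at the front.\<close>
    have arg: "c * d * ?y = x * Q" "c * ?y = a * b * c * x" "c * d * a * ?y = a * x * Q"
      "a * b * x = ?y"
      by (simp_all add: Q mult_ac)
    have "even_fps (Suc (2 * M)) x a b c d * (lprod Q (- ?y) (Suc M) * lprod Q (- x) (Suc M))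
        = (lin (- x) * even_fps (Suc (2 * M)) x a b c d)
            * (lprod Q (- (x * Q)) M * lprod Q (- ?y) (Suc M))"
      unfolding lprod_Suc_shift[of Q "- x" M] by (simp add: mult_ac)
    also have "\<dots> = lin (a * x)
        * (even_fps (2 * M) ?y c d a b * (lprod Q (- (x * Q)) M * lprod Q (- ?y) (Suc M)))"
      by (simp only: even_fps_Suc mult.assoc)
    also have "\<dots> = lprod Q (a * x) (Suc M) * lprod Q (a * b * c * x) M"
      using IH unfolding arg lprod_Suc_shift[of Q "a * x" M] by (simp only: mult_ac)
    finally show ?thesis
      unfolding arg .
  qed
  have even: "even_fps (2 * M) x a b c d * (lprod Q (- (a * b * x)) M * lprod Q (- x) (Suc M))
           = lprod Q (a * x) M * lprod Q (a * b * c * x) M"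
    if "Q = a * b * c * d" for M and x a b c d :: 'a
    using that
  proof (induction M arbitrary: x a b c d)
    case 0
    then show ?case
      using even_fps_0[of x a b c d] by (simp add: lprod_Suc mult.commute)
  next
    case (Suc M)
    let ?y = "x * (a * b)"
    have "Q = c * d * a * b" by (simp add: Suc.prems mult_ac)
    \<comment> \<open>\<open>step\<close> gives the case 2M+1 at the swapped labels; one more row
      deletion then reaches 2M+2.\<close>
    note IH = step[OF Suc.IH this, of ?y]
    have arg: "c * d * ?y = x * Q" "c * ?y = a * b * c * x" "c * d * a * ?y = a * x * Q"
      "a * b * x = ?y"
      by (simp_all add: Suc.prems mult_ac)
    have "even_fps (2 * Suc M) x a b c d
          * (lprod Q (- ?y) (Suc M) * lprod Q (- x) (Suc (Suc M)))
        = (lin (- x) * even_fps (Suc (Suc (2 * M))) x a b c d)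
            * (lprod Q (- (x * Q)) (Suc M) * lprod Q (- ?y) (Suc M))"
      unfolding lprod_Suc_shift[of Q "- x" "Suc M"] by (simp add: mult_ac)
    also have "\<dots> = lin (a * x) * (even_fps (Suc (2 * M)) ?y c d a b
            * (lprod Q (- (x * Q)) (Suc M) * lprod Q (- ?y) (Suc M)))"
      by (simp only: even_fps_Suc mult.assoc)
    also have "\<dots> = lprod Q (a * x) (Suc M) * lprod Q (a * b * c * x) (Suc M)"
      using IH unfolding arg lprod_Suc_shift[of Q "a * x" M] by (simp only: mult_ac)
    finally show ?case
      unfolding arg .
  qed
  show "even_fps (2 * M) x a b c d * (lprod Q (- (a * b * x)) M * lprod Q (- x) (Suc M))
           = lprod Q (a * x) M * lprod Q (a * b * c * x) M"
    using assms by (rule even)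
  show "even_fps (Suc (2 * M)) x a b c d
             * (lprod Q (- (a * b * x)) (Suc M) * lprod Q (- x) (Suc M))
           = lprod Q (a * x) (Suc M) * lprod Q (a * b * c * x) M"
    using even assms by (rule step)
qed

text \<open>One row deletion reduces to the even bounds at argument ab, so no induction is required.
  The constant 1 + a takes the place of the factor 1 + az, which is why the numerator starts at
  \<open>a * Q\<close>.\<close>

lemma odd_fps_product:
  fixes a b c d :: "'a::comm_ring_1"
  assumes Q: "Q = a * b * c * d"
  shows "odd_fps (Suc (2 * M)) 1 a b c d * (lprod Q (- (a * b)) (Suc M) * lprod Q (- 1) (Suc M))
           = fps_const (1 + a) * (lprod Q (a * Q) M * lprod Q (a * b * c) M)"
    and "odd_fps (Suc (Suc (2 * M))) 1 a b c d
             * (lprod Q (- (a * b)) (Suc M) * lprod Q (- 1) (Suc (Suc M)))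
           = fps_const (1 + a) * (lprod Q (a * Q) M * lprod Q (a * b * c) (Suc M))"
proof -
  have Q': "Q = c * d * a * b" by (simp add: Q mult_ac)
  have arg: "c * d * (1 * (a * b)) = Q" "c * (1 * (a * b)) = a * b * c"
    "c * d * a * (1 * (a * b)) = a * Q"
    by (simp_all add: Q mult_ac)
  have fact: "odd_fps (Suc K) 1 a b c d * (A * lprod Q (- 1) (Suc n))
      = fps_const (1 + a) * (even_fps K (1 * (a * b)) c d a b * (lprod Q (- Q) n * A))" for K n A
  proof -
    have "odd_fps (Suc K) 1 a b c d * (A * lprod Q (- 1) (Suc n))
        = (lin (- 1) * odd_fps (Suc K) 1 a b c d) * (lprod Q (- Q) n * A)"
      unfolding lprod_Suc_shift[of Q "- 1" n] by (simp add: mult_ac)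
    then show ?thesis
      by (simp only: odd_fps_Suc mult.assoc)
  qed
  show "odd_fps (Suc (2 * M)) 1 a b c d * (lprod Q (- (a * b)) (Suc M) * lprod Q (- 1) (Suc M))
      = fps_const (1 + a) * (lprod Q (a * Q) M * lprod Q (a * b * c) M)"
    using even_fps_product(1)[OF Q', of M "1 * (a * b)"]
    unfolding fact arg by (simp add: mult.commute)
  show "odd_fps (Suc (Suc (2 * M))) 1 a b c d
        * (lprod Q (- (a * b)) (Suc M) * lprod Q (- 1) (Suc (Suc M)))
      = fps_const (1 + a) * (lprod Q (a * Q) M * lprod Q (a * b * c) (Suc M))"
    using even_fps_product(2)[OF Q', of M "1 * (a * b)"]
    unfolding fact arg by (simp add: mult.commute)
qed

section \<open>Comparison of coefficients\<close>

lemma qpos_qneg_nth: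
  "(qpos q x k * qpos q y l * (qneg q u m * qneg q v n)) $ N =
     (\<Sum>(m1, m2, m3, m4)\<in>quads N.
        (qbinom (int k) (int m1) q * x ^ m1 * q ^ (m1 choose 2)) *
        (qbinom (int (m + m2)) (int m2) q * u ^ m2) *
        (qbinom (int l) (int m3) q * y ^ m3 * q ^ (m3 choose 2)) *
        (qbinom (int (n + m4)) (int m4) q * v ^ m4))"
proof -
  have "qpos q x k * qpos q y l * (qneg q u m * qneg q v n)
      = (qpos q x k * qneg q u m) * (qpos q y l * qneg q v n)"
    by (simp only: mult_ac)
  then show ?thesis
    by (simp only: fps_mult4_nth) (simp add: qpos_def qneg_def)
qed

theorem theorem4p6:
  fixes a b c d Q :: "'a::comm_ring_1" and N M :: nat
  assumes "Q = a * b * c * d"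
  shows
    "(\<Sum>p \<in> S2 (2 * N) (2 * M + 1). omega2 a b c d p) =
       (\<Sum>(m1, m2, m3, m4) \<in> quads N.
          qbinom (int M + 1) (int m1) Q * a ^ m1 * Q ^ (m1 choose 2) *
          qbinom (int M + int m2) (int m2) Q * (a * b) ^ m2 *
          qbinom (int M) (int m3) Q * (a * b * c) ^ m3 * Q ^ (m3 choose 2) *
          qbinom (int M + int m4) (int m4) Q)
     \<and>
     (\<Sum>p \<in> S2 (2 * N + 1) (2 * M + 1). omega2 a b c d p) =
       (\<Sum>(m1, m2, m3, m4) \<in> quads N.
          qbinom (int M) (int m1) Q * (1 + a) * a ^ m1 * Q ^ ((m1 + 1) choose 2) *
          qbinom (int M + int m2) (int m2) Q * (a * b) ^ m2 *
          qbinom (int M) (int m3) Q * (a * b * c) ^ m3 * Q ^ (m3 choose 2) *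
          qbinom (int M + int m4) (int m4) Q)
     \<and>
     (M \<ge> 1 \<longrightarrow>
     (\<Sum>p \<in> S2 (2 * N) (2 * M). omega2 a b c d p) =
       (\<Sum>(m1, m2, m3, m4) \<in> quads N.
          qbinom (int M) (int m1) Q * a ^ m1 * Q ^ (m1 choose 2) *
          qbinom (int M + int m2 - 1) (int m2) Q * (a * b) ^ m2 *
          qbinom (int M) (int m3) Q * (a * b * c) ^ m3 * Q ^ (m3 choose 2) *
          qbinom (int M + int m4) (int m4) Q))
     \<and>
     (M \<ge> 1 \<longrightarrow>
     (\<Sum>p \<in> S2 (2 * N + 1) (2 * M). omega2 a b c d p) =
       (\<Sum>(m1, m2, m3, m4) \<in> quads N.
          qbinom (int M - 1) (int m1) Q * (1 + a) * a ^ m1 * Q ^ ((m1 + 1) choose 2) *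
          qbinom (int M + int m2 - 1) (int m2) Q * (a * b) ^ m2 *
          qbinom (int M) (int m3) Q * (a * b * c) ^ m3 * Q ^ (m3 choose 2) *
          qbinom (int M + int m4) (int m4) Q))"
proof -
  \<comment> \<open>Starting a product at \<open>a * Q\<close> instead of \<open>a\<close>
    contributes Q^m, which accounts for \<open>(m + 1) choose 2\<close> in the formulas with odd
    bound.\<close>
  have shift: "Q ^ ((m + 1) choose 2) = Q ^ m * Q ^ (m choose 2)" for m
    by (simp add: numeral_2_eq_2 power_add)
  have even_nth: "(\<Sum>p \<in> S2 (2 * N) K. omega2 a b c d p) = even_fps K 1 a b c d $ N" for K
    by (simp add: even_fps_def S2_gf_def)
  have odd_nth: "(\<Sum>p \<in> S2 (2 * N + 1) K. omega2 a b c d p) = odd_fps K 1 a b c d $ N" for K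
    by (simp add: odd_fps_def S2_gf_def)
  show ?thesis
  proof (intro conjI impI)
    have 1: "even_fps (2 * M + 1) 1 a b c d = qpos Q a (Suc M) * qpos Q (a * b * c) M
        * (qneg Q (a * b) M * qneg Q 1 M)"
      using even_fps_product(2)[OF assms, of M 1]
      by (intro lprod_cancel) (simp add: lprod_eq_qpos)
    show "(\<Sum>p \<in> S2 (2 * N) (2 * M + 1). omega2 a b c d p) =
         (\<Sum>(m1, m2, m3, m4) \<in> quads N.
            qbinom (int M + 1) (int m1) Q * a ^ m1 * Q ^ (m1 choose 2) *
            qbinom (int M + int m2) (int m2) Q * (a * b) ^ m2 *
            qbinom (int M) (int m3) Q * (a * b * c) ^ m3 * Q ^ (m3 choose 2) *
            qbinom (int M + int m4) (int m4) Q)"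
      unfolding even_nth 1 qpos_qneg_nth
      by (intro sum.cong) (auto simp: mult.assoc add.commute)
    have 2: "odd_fps (2 * M + 1) 1 a b c d = fps_const (1 + a)
        * (qpos Q (a * Q) M * qpos Q (a * b * c) M * (qneg Q (a * b) M * qneg Q 1 M))"
      using odd_fps_product(1)[OF assms, of M] unfolding mult.assoc[symmetric, of "fps_const (1 + a)"]
      by (intro lprod_cancel) (simp add: lprod_eq_qpos mult.assoc)
    show "(\<Sum>p \<in> S2 (2 * N + 1) (2 * M + 1). omega2 a b c d p) =
         (\<Sum>(m1, m2, m3, m4) \<in> quads N.
            qbinom (int M) (int m1) Q * (1 + a) * a ^ m1 * Q ^ ((m1 + 1) choose 2) *
            qbinom (int M + int m2) (int m2) Q * (a * b) ^ m2 *
            qbinom (int M) (int m3) Q * (a * b * c) ^ m3 * Q ^ (m3 choose 2) *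
            qbinom (int M + int m4) (int m4) Q)"
      unfolding odd_nth 2 fps_mult_left_const_nth qpos_qneg_nth sum_distrib_left shift
      by (intro sum.cong) (auto simp: power_mult_distrib mult_ac)
  next
    assume "M \<ge> 1"
    \<comment> \<open>The denominator product starting at ab has only M = L + 1 factors, so its
      reciprocal is \<open>qneg\<close> at L = M - 1. For M = 0 the product is empty, while the
      Gaussian binomial at (-1, 0) is 0 by convention.\<close>
    then obtain L where M: "M = Suc L"
      by (cases M) auto
    have 3: "even_fps (2 * M) 1 a b c d = qpos Q a M * qpos Q (a * b * c) M
        * (qneg Q (a * b) L * qneg Q 1 M)"
      using even_fps_product(1)[OF assms, of M 1] unfolding M
      by (intro lprod_cancel) (simp add: lprod_eq_qpos)
    show "(\<Sum>p \<in> S2 (2 * N) (2 * M). omega2 a b c d p) =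
         (\<Sum>(m1, m2, m3, m4) \<in> quads N.
            qbinom (int M) (int m1) Q * a ^ m1 * Q ^ (m1 choose 2) *
            qbinom (int M + int m2 - 1) (int m2) Q * (a * b) ^ m2 *
            qbinom (int M) (int m3) Q * (a * b * c) ^ m3 * Q ^ (m3 choose 2) *
            qbinom (int M + int m4) (int m4) Q)"
      unfolding even_nth 3 qpos_qneg_nth
      by (intro sum.cong) (auto simp: M mult.assoc add.assoc)
  next
    assume "M \<ge> 1"
    then obtain L where M: "M = Suc L"
      by (cases M) auto
    \<comment> \<open>Here 2M = 2L + 2, and the numerator product starting at \<open>a * Q\<close>
      has just L = M - 1 factors.\<close>
    have 4: "odd_fps (2 * M) 1 a b c d = fps_const (1 + a)
        * (qpos Q (a * Q) L * qpos Q (a * b * c) M * (qneg Q (a * b) L * qneg Q 1 M))"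
      using odd_fps_product(2)[OF assms, of L] unfolding M mult.assoc[symmetric, of "fps_const (1 + a)"]
      by (intro lprod_cancel) (simp add: lprod_eq_qpos mult.assoc)
    show "(\<Sum>p \<in> S2 (2 * N + 1) (2 * M). omega2 a b c d p) =
         (\<Sum>(m1, m2, m3, m4) \<in> quads N.
            qbinom (int M - 1) (int m1) Q * (1 + a) * a ^ m1 * Q ^ ((m1 + 1) choose 2) *
            qbinom (int M + int m2 - 1) (int m2) Q * (a * b) ^ m2 *
            qbinom (int M) (int m3) Q * (a * b * c) ^ m3 * Q ^ (m3 choose 2) *
            qbinom (int M + int m4) (int m4) Q)"
      unfolding odd_nth 4 fps_mult_left_const_nth qpos_qneg_nth sum_distrib_left shift
      by (intro sum.cong) (auto simp: M power_mult_distrib mult_ac add.assoc)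
  qed
qed

end
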